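(* Let $E$ be a complex Banach lattice with positive cone $E_+$, and let $(P_n)_{n\in\mathbb{N}}$ be an increasing sequence of positive operators on $E$ converging strongly to the identity. Let $(e^{tA})_{t\ge 0}$ be a $C_0$-semigroup on $E$. If $(e^{tA})_{t\ge 0}$ has the LEP property with respect to $(P_n)_{n\in\mathbb{N}}$, and for every $x\in E$ the orbit $\{e^{tA}x:t\ge 0\}$ is relatively compact in $E$, then for every $x\in E_+$ it holds that $$\operatorname{dist}(e^{tA}x,E_+)\longrightarrow 0\quad\text{as } t\to\infty.$$
   Context: A complex Banach lattice $E$ is the complexification of a real Banach lattice $E_{\mathbb{R}}$; $E_+$ is the positive cone of $E_{\mathbb{R}}$. A linear operator $T$ on $E$ is positive if $T(E_+)\subseteq E_+$. A sequence $(P_n)$ of positive operators is increasing if $P_{n+1}-P_n$ is positive for all $n$. A $C_0$-semigroup $(e^{tA})_{t\ge 0}$ on $E$ with generator $A$ has the LEP (local eventual positivity) property with respect to $(P_n)$ if for every $n\in\mathbb{N}$ and $f\in E_+\setminus\{0\}$ there exists $\tau>0$ (depending on $n$ and $f$) such that $P_ne^{tA}f\ge 0$ for all $t\ge\tau$. *)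

theory Defs
  imports "HOL-Analysis.Analysis" "HOL-Library.Lattice_Algebras"
begin

section \<open>Real Banach lattices\<close>

class banach_lattice = banach + lattice_ab_group_add_abs + ordered_real_vector +
  assumes norm_le_of_abs_le: "\<bar>x\<bar> \<le> \<bar>y\<bar> \<Longrightarrow> norm x \<le> norm y"

instance real :: banach_lattice
  by standard auto

lemma banach_lattice_norm_abs [simp]: "norm \<bar>x\<bar> = norm (x :: 'a :: banach_lattice)"
  by (intro antisym norm_le_of_abs_le) simp_all

lemma banach_lattice_norm_mono:
  fixes x y :: "'a :: banach_lattice"
  assumes "0 \<le> x" "x \<le> y"
  shows "norm x \<le> norm y"
proof -
  have "0 \<le> y" using assms by (rule order_trans)
  with assms show ?thesis by (intro norm_le_of_abs_le) simp
qed

lemma banach_lattice_LIMSEQ_nonneg: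
  fixes y :: "'a :: banach_lattice"
  assumes lim: "Y \<longlonglongrightarrow> y" and nonneg: "\<And>n. 0 \<le> Y n"
  shows "0 \<le> y"
proof -
  have "norm (sup (- y) 0) \<le> norm (Y n - y)" for n
  proof -
    have "- y \<le> Y n - y" using nonneg[of n] by simp
    also have "\<dots> \<le> \<bar>Y n - y\<bar>" by (rule abs_ge_self)
    finally have "sup (- y) 0 \<le> \<bar>Y n - y\<bar>" by simp
    then have "norm (sup (- y) 0) \<le> norm \<bar>Y n - y\<bar>"
      by (intro banach_lattice_norm_mono) simp_all
    then show ?thesis by simp
  qed
  moreover have "(\<lambda>n. norm (Y n - y)) \<longlonglongrightarrow> 0"
    using lim by (simp add: LIM_zero tendsto_norm_zero)
  ultimately have "norm (sup (- y) 0) \<le> 0"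
    by (intro LIMSEQ_le_const[where X = "\<lambda>n. norm (Y n - y)"]) auto
  then have "sup (- y) 0 = 0" by simp
  then have "- y \<le> 0" by (metis sup_ge1)
  then show ?thesis by simp
qed

lemma banach_lattice_LIMSEQ_mono:
  fixes x y :: "'a :: banach_lattice"
  assumes "X \<longlonglongrightarrow> x" "Y \<longlonglongrightarrow> y" "\<And>n. X n \<le> Y n"
  shows "x \<le> y"
  using banach_lattice_LIMSEQ_nonneg[OF tendsto_diff[OF assms(2,1)]] assms(3) by simp

lemma banach_lattice_sup_exists:
  fixes S :: "'a :: banach_lattice set" and u :: 'a
  assumes ne: "S \<noteq> {}"
    and tb: "\<And>e::real. 0 < e \<Longrightarrow> \<exists>F. finite F \<and> F \<subseteq> S \<and> (\<forall>s\<in>S. \<exists>f\<in>F. s \<le> f + e *\<^sub>R u)"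
  shows "\<exists>m. (\<forall>s\<in>S. s \<le> m) \<and> (\<forall>v. (\<forall>s\<in>S. s \<le> v) \<longrightarrow> m \<le> v)"
proof -
  have "\<exists>F. \<forall>n. finite (F n) \<and> F n \<subseteq> S \<and> (\<forall>s\<in>S. \<exists>f\<in>F n. s \<le> f + ((1/2)^n) *\<^sub>R u)"
    by (intro choice allI tb) simp
  then obtain F where fin: "\<And>n. finite (F n)" and sub: "\<And>n. F n \<subseteq> S"
    and cov: "\<And>n s. s \<in> S \<Longrightarrow> \<exists>f\<in>F n. s \<le> f + ((1/2)^n) *\<^sub>R u"
    by blast
  define G where "G n = (\<Union>k\<le>n. F k)" for n
  have Gfin: "finite (G n)" and Gsub: "G n \<subseteq> S" for n
    using fin sub by (auto simp: G_def)
  have FG: "F n \<subseteq> G n" for n by (auto simp: G_def)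
  have Gne: "G n \<noteq> {}" for n
    using ne cov[of _ n] FG[of n] by blast
  define s where "s n = Sup_fin (G n)" for n
  have ub: "x \<le> s n + ((1/2)^n) *\<^sub>R u" if "x \<in> S" for x n
  proof -
    obtain f where f: "f \<in> F n" "x \<le> f + ((1/2)^n) *\<^sub>R u" using cov[OF \<open>x \<in> S\<close>] by blast
    have "f \<le> s n" unfolding s_def
      using f(1) FG[of n] Gfin by (intro Sup_fin.coboundedI) auto
    then show ?thesis using f(2) by (meson add_right_mono order_trans)
  qed
  have inc: "s n \<le> s (Suc n)" for n
    unfolding s_def by (intro Sup_fin.subset_imp Gne Gfin) (auto simp: G_def intro: le_SucI)
  have step: "s (Suc n) \<le> s n + ((1/2)^n) *\<^sub>R u" for n
    unfolding s_def[of "Suc n"] using Gsub ub by (intro Sup_fin.boundedI Gfin Gne) auto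
  have bound: "norm (s (Suc n) - s n) \<le> (1/2)^n * norm u" for n
  proof -
    have "norm (s (Suc n) - s n) \<le> norm (((1/2)^n) *\<^sub>R u)"
      using inc[of n] step[of n] by (intro banach_lattice_norm_mono) (simp_all add: algebra_simps)
    then show ?thesis by simp
  qed
  have "summable (\<lambda>n. (1/2::real)^n * norm u)"
    by (rule summable_mult2) (simp add: summable_geometric)
  then have "summable (\<lambda>n. s (Suc n) - s n)"
    by (rule summable_comparison_test'[where N = 0]) (rule bound)
  then have "convergent (\<lambda>n. \<Sum>k<n. s (Suc k) - s k)"
    by (simp add: summable_iff_convergent)
  then have "convergent (\<lambda>n. s n - s 0)"
    by (simp add: sum_lessThan_telescope)
  then obtain l where "(\<lambda>n. s n - s 0) \<longlonglongrightarrow> l" by (auto simp: convergent_def)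
  from tendsto_add[OF this tendsto_const[of "s 0"]] have lim: "s \<longlonglongrightarrow> l + s 0" by simp
  have lim2: "(\<lambda>n. s n + ((1/2)^n) *\<^sub>R u) \<longlonglongrightarrow> (l + s 0) + 0 *\<^sub>R u"
    by (intro tendsto_add lim tendsto_scaleR tendsto_const LIMSEQ_realpow_zero) auto
  show ?thesis
  proof (intro exI conjI ballI allI impI)
    fix x assume "x \<in> S"
    then show "x \<le> l + s 0"
      using banach_lattice_LIMSEQ_mono[OF tendsto_const lim2, of x] ub by simp
  next
    fix v assume v: "\<forall>x\<in>S. x \<le> v"
    have "s n \<le> v" for n
      unfolding s_def using Gsub v by (intro Sup_fin.boundedI Gfin Gne) auto
    then show "l + s 0 \<le> v"
      by (intro banach_lattice_LIMSEQ_mono[OF lim tendsto_const])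
  qed
qed


section \<open>Complexification\<close>

datatype 'a complexification = Cplx (cRe: 'a) (cIm: 'a)

lemma complexification_eq_iff: "z = w \<longleftrightarrow> cRe z = cRe w \<and> cIm z = cIm w"
  by (cases z; cases w) simp

text \<open>
  The modulus of x + iy is the supremum of all (cos \<theta>) x + (sin \<theta>) y in the real Banach lattice
  (it exists, see \<open>modulus_upper\<close> and \<open>modulus_least\<close> below), and the norm of x + iy is the norm
  of its modulus.
\<close>

definition modulus :: "'a :: banach_lattice complexification \<Rightarrow> 'a" where
  "modulus z = (LEAST u. \<forall>\<theta>::real. cos \<theta> *\<^sub>R cRe z + sin \<theta> *\<^sub>R cIm z \<le> u)"

lemma scaleR_le_abs:
  fixes x :: "'a :: banach_lattice"
  shows "a *\<^sub>R x \<le> \<bar>a\<bar> *\<^sub>R \<bar>x\<bar>"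
proof (cases "0 \<le> a")
  case True
  then show ?thesis by (simp add: scaleR_left_mono abs_ge_self)
next
  case False
  then have "(- a) *\<^sub>R (- x) \<le> (- a) *\<^sub>R \<bar>x\<bar>"
    by (intro scaleR_left_mono) (simp_all add: abs_ge_minus_self)
  with False show ?thesis by simp
qed

lemma modulus_exists:
  fixes x y :: "'a :: banach_lattice"
  shows "\<exists>m. (\<forall>\<theta>::real. cos \<theta> *\<^sub>R x + sin \<theta> *\<^sub>R y \<le> m) \<and>
             (\<forall>v. (\<forall>\<theta>::real. cos \<theta> *\<^sub>R x + sin \<theta> *\<^sub>R y \<le> v) \<longrightarrow> m \<le> v)"
proof -
  define g where "g w = Re w *\<^sub>R x + Im w *\<^sub>R y" for w
  define S where "S = range (\<lambda>\<theta>. cos \<theta> *\<^sub>R x + sin \<theta> *\<^sub>R y)"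
  have S: "S = g ` sphere 0 1"
  proof -
    have "sphere (0::complex) 1 = range cis"
    proof (intro set_eqI iffI)
      fix w :: complex assume "w \<in> sphere 0 1"
      then have "w = cis (Arg w)" using rcis_cmod_Arg[of w] by (simp add: rcis_def)
      then show "w \<in> range cis" by blast
    qed auto
    then show ?thesis by (simp add: S_def g_def image_image)
  qed
  have "\<exists>m. (\<forall>s\<in>S. s \<le> m) \<and> (\<forall>v. (\<forall>s\<in>S. s \<le> v) \<longrightarrow> m \<le> v)"
  proof (rule banach_lattice_sup_exists[where u = "\<bar>x\<bar> + \<bar>y\<bar>"])
    show "S \<noteq> {}" by (auto simp: S_def)
  next
    fix e :: real assume e: "0 < e"
    have "sphere (0::complex) 1 \<subseteq> (\<Union>k\<in>sphere 0 1. ball k e)" using e by force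
    then obtain K where K: "K \<subseteq> sphere 0 1" "finite K" "sphere (0::complex) 1 \<subseteq> (\<Union>k\<in>K. ball k e)"
      using compactE_image[of "sphere (0::complex) 1" "sphere 0 1" "\<lambda>k. ball k e"]
      by (metis compact_sphere open_ball)
    have "\<exists>f\<in>g ` K. s \<le> f + e *\<^sub>R (\<bar>x\<bar> + \<bar>y\<bar>)" if "s \<in> S" for s
    proof -
      from that obtain w where w: "s = g w" "w \<in> sphere 0 1" unfolding S by blast
      with K(3) obtain k where k: "k \<in> K" "dist k w < e" by (auto simp: subset_iff)
      have d: "\<bar>Re (w - k)\<bar> \<le> e" "\<bar>Im (w - k)\<bar> \<le> e"
        using abs_Re_le_cmod[of "w - k"] abs_Im_le_cmod[of "w - k"] k(2)
        by (auto simp: dist_norm norm_minus_commute)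
      have "g w - g k = Re (w - k) *\<^sub>R x + Im (w - k) *\<^sub>R y"
        by (simp add: g_def algebra_simps)
      also have "\<dots> \<le> \<bar>Re (w - k)\<bar> *\<^sub>R \<bar>x\<bar> + \<bar>Im (w - k)\<bar> *\<^sub>R \<bar>y\<bar>"
        by (intro add_mono scaleR_le_abs)
      also have "\<dots> \<le> e *\<^sub>R \<bar>x\<bar> + e *\<^sub>R \<bar>y\<bar>"
        by (intro add_mono scaleR_right_mono d) simp_all
      finally show ?thesis using k(1) w(1) by (auto simp: algebra_simps)
    qed
    then show "\<exists>F. finite F \<and> F \<subseteq> S \<and> (\<forall>s\<in>S. \<exists>f\<in>F. s \<le> f + e *\<^sub>R (\<bar>x\<bar> + \<bar>y\<bar>))"
      using K(1,2) by (intro exI[of _ "g ` K"]) (auto simp: S)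
  qed
  then show ?thesis by (simp add: S_def)
qed

lemma
  fixes z :: "'a :: banach_lattice complexification"
  shows modulus_upper: "cos \<theta> *\<^sub>R cRe z + sin \<theta> *\<^sub>R cIm z \<le> modulus z"
    and modulus_least: "(\<And>\<theta>. cos \<theta> *\<^sub>R cRe z + sin \<theta> *\<^sub>R cIm z \<le> u) \<Longrightarrow> modulus z \<le> u"
proof -
  obtain m where m: "\<And>\<theta>. cos \<theta> *\<^sub>R cRe z + sin \<theta> *\<^sub>R cIm z \<le> m"
    "\<And>v. (\<And>\<theta>. cos \<theta> *\<^sub>R cRe z + sin \<theta> *\<^sub>R cIm z \<le> v) \<Longrightarrow> m \<le> v"
    using modulus_exists[of "cRe z" "cIm z"] by blast
  have "modulus z = m"
    unfolding modulus_def by (rule Least_equality) (auto intro: m)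
  with m show "cos \<theta> *\<^sub>R cRe z + sin \<theta> *\<^sub>R cIm z \<le> modulus z"
    and "(\<And>\<theta>. cos \<theta> *\<^sub>R cRe z + sin \<theta> *\<^sub>R cIm z \<le> u) \<Longrightarrow> modulus z \<le> u" by auto
qed

lemma abs_cRe_le_modulus: "\<bar>cRe z\<bar> \<le> modulus z"
  using modulus_upper[of 0 z] modulus_upper[of pi z] by (simp add: abs_leI)

lemma abs_cIm_le_modulus: "\<bar>cIm z\<bar> \<le> modulus z"
  using modulus_upper[of "pi/2" z] modulus_upper[of "- (pi/2)" z] by (simp add: abs_leI)

lemma modulus_nonneg: "0 \<le> modulus z"
  using abs_cRe_le_modulus[of z] abs_ge_zero order_trans by blast

lemma modulus_le: "modulus z \<le> \<bar>cRe z\<bar> + \<bar>cIm z\<bar>"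
proof (rule modulus_least)
  fix \<theta> :: real
  have "cos \<theta> *\<^sub>R cRe z + sin \<theta> *\<^sub>R cIm z \<le> \<bar>cos \<theta>\<bar> *\<^sub>R \<bar>cRe z\<bar> + \<bar>sin \<theta>\<bar> *\<^sub>R \<bar>cIm z\<bar>"
    by (intro add_mono scaleR_le_abs)
  also have "\<dots> \<le> 1 *\<^sub>R \<bar>cRe z\<bar> + 1 *\<^sub>R \<bar>cIm z\<bar>"
    by (intro add_mono scaleR_right_mono) simp_all
  finally show "cos \<theta> *\<^sub>R cRe z + sin \<theta> *\<^sub>R cIm z \<le> \<bar>cRe z\<bar> + \<bar>cIm z\<bar>" by simp
qed

instantiation complexification :: (banach_lattice) real_vector
begin

definition "0 = Cplx (0::'a) 0"
definition "z + w = Cplx (cRe z + cRe w) (cIm z + cIm w)" for z w :: "'a complexification"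
definition "- z = Cplx (- cRe z) (- cIm z)" for z :: "'a complexification"
definition "z - w = Cplx (cRe z - cRe w) (cIm z - cIm w)" for z w :: "'a complexification"
definition "r *\<^sub>R z = Cplx (r *\<^sub>R cRe z) (r *\<^sub>R cIm z)" for z :: "'a complexification"

instance
  by standard (simp_all add: complexification_eq_iff algebra_simps zero_complexification_def
      plus_complexification_def uminus_complexification_def minus_complexification_def
      scaleR_complexification_def)

end

lemma cRe_simps [simp]:
  fixes z w :: "'a :: banach_lattice complexification"
  shows "cRe (0 :: 'a complexification) = 0" "cRe (z + w) = cRe z + cRe w" "cRe (- z) = - cRe z"
  "cRe (z - w) = cRe z - cRe w" "cRe (r *\<^sub>R z) = r *\<^sub>R cRe z"
  by (simp_all add: zero_complexification_def plus_complexification_def uminus_complexification_def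
      minus_complexification_def scaleR_complexification_def)

lemma cIm_simps [simp]:
  fixes z w :: "'a :: banach_lattice complexification"
  shows "cIm (0 :: 'a complexification) = 0" "cIm (z + w) = cIm z + cIm w" "cIm (- z) = - cIm z"
  "cIm (z - w) = cIm z - cIm w" "cIm (r *\<^sub>R z) = r *\<^sub>R cIm z"
  by (simp_all add: zero_complexification_def plus_complexification_def uminus_complexification_def
      minus_complexification_def scaleR_complexification_def)

lemma modulus_add_le: "modulus (z + w) \<le> modulus z + modulus w"
proof (rule modulus_least)
  fix \<theta> :: real
  have "cos \<theta> *\<^sub>R cRe (z + w) + sin \<theta> *\<^sub>R cIm (z + w) =
      (cos \<theta> *\<^sub>R cRe z + sin \<theta> *\<^sub>R cIm z) + (cos \<theta> *\<^sub>R cRe w + sin \<theta> *\<^sub>R cIm w)"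
    by (simp add: algebra_simps)
  also have "\<dots> \<le> modulus z + modulus w"
    by (intro add_mono modulus_upper)
  finally show "cos \<theta> *\<^sub>R cRe (z + w) + sin \<theta> *\<^sub>R cIm (z + w) \<le> modulus z + modulus w" .
qed

lemma modulus_scaleR_le: "modulus (r *\<^sub>R z) \<le> \<bar>r\<bar> *\<^sub>R modulus z"
proof (rule modulus_least)
  fix \<theta> :: real
  define \<phi> where "\<phi> = (if r < 0 then \<theta> + pi else \<theta>)"
  have "cos \<theta> *\<^sub>R cRe (r *\<^sub>R z) + sin \<theta> *\<^sub>R cIm (r *\<^sub>R z) =
      \<bar>r\<bar> *\<^sub>R (cos \<phi> *\<^sub>R cRe z + sin \<phi> *\<^sub>R cIm z)"
    by (simp add: \<phi>_def algebra_simps)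
  also have "\<dots> \<le> \<bar>r\<bar> *\<^sub>R modulus z"
    by (intro scaleR_left_mono modulus_upper) simp
  finally show "cos \<theta> *\<^sub>R cRe (r *\<^sub>R z) + sin \<theta> *\<^sub>R cIm (r *\<^sub>R z) \<le> \<bar>r\<bar> *\<^sub>R modulus z" .
qed

lemma modulus_eq_0_iff: "modulus z = 0 \<longleftrightarrow> z = 0"
proof
  assume "modulus z = 0"
  then show "z = 0"
    using abs_cRe_le_modulus[of z] abs_cIm_le_modulus[of z] by (simp add: complexification_eq_iff)
next
  assume "z = 0"
  then show "modulus z = 0"
    by (intro antisym modulus_nonneg) (use modulus_le[of z] in simp)
qed

instantiation complexification :: (banach_lattice) real_normed_vector
begin

definition "norm z = norm (modulus z)" for z :: "'a complexification"
definition "sgn z = z /\<^sub>R norm z" for z :: "'a complexification"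
definition "dist z w = norm (z - w)" for z w :: "'a complexification"
definition [code del]:
  "(uniformity :: ('a complexification \<times> 'a complexification) filter) =
     (INF e\<in>{0 <..}. principal {(z, w). dist z w < e})"
definition [code del]:
  "open (U :: 'a complexification set) \<longleftrightarrow>
     (\<forall>z\<in>U. eventually (\<lambda>(z', w). z' = z \<longrightarrow> w \<in> U) uniformity)"

lemma norm_scaleR_complexification_le:
  "norm (r *\<^sub>R z) \<le> \<bar>r\<bar> * norm z" for z :: "'a complexification"
  using banach_lattice_norm_mono[OF modulus_nonneg modulus_scaleR_le, of r z]
  by (simp add: norm_complexification_def)

instance
proof
  fix r s :: real and x y z :: "'a complexification"
  show "norm x = 0 \<longleftrightarrow> x = 0"
    by (simp add: norm_complexification_def modulus_eq_0_iff)
  have "norm (modulus (x + y)) \<le> norm (modulus x + modulus y)"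
    by (intro banach_lattice_norm_mono modulus_nonneg modulus_add_le)
  also have "\<dots> \<le> norm (modulus x) + norm (modulus y)" by (rule norm_triangle_ineq)
  finally show "norm (x + y) \<le> norm x + norm y" by (simp add: norm_complexification_def)
  show "norm (r *\<^sub>R x) = \<bar>r\<bar> * norm x"
  proof (cases "r = 0")
    case True
    then show ?thesis
      using norm_scaleR_complexification_le[of r x] by (simp add: norm_complexification_def)
  next
    case False
    have "x = inverse r *\<^sub>R (r *\<^sub>R x)" using False by (simp add: complexification_eq_iff)
    then have "norm x \<le> \<bar>inverse r\<bar> * norm (r *\<^sub>R x)"
      by (metis norm_scaleR_complexification_le)
    then have "\<bar>r\<bar> * norm x \<le> norm (r *\<^sub>R x)" using False by (simp add: field_simps)
    then show ?thesis using norm_scaleR_complexification_le[of r x] by simp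
  qed
qed (rule sgn_complexification_def dist_complexification_def
    open_complexification_def uniformity_complexification_def)+

end

lemma norm_cRe_le: "norm (cRe z) \<le> norm z"
  unfolding norm_complexification_def
  using abs_cRe_le_modulus[of z] by (intro norm_le_of_abs_le) (simp add: modulus_nonneg)

lemma norm_cIm_le: "norm (cIm z) \<le> norm z"
  unfolding norm_complexification_def
  using abs_cIm_le_modulus[of z] by (intro norm_le_of_abs_le) (simp add: modulus_nonneg)

lemma norm_complexification_le: "norm z \<le> norm (cRe z) + norm (cIm z)"
proof -
  have "norm z \<le> norm (\<bar>cRe z\<bar> + \<bar>cIm z\<bar>)"
    unfolding norm_complexification_def
    by (intro banach_lattice_norm_mono modulus_nonneg modulus_le)
  also have "\<dots> \<le> norm (cRe z) + norm (cIm z)"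
    using norm_triangle_ineq[of "\<bar>cRe z\<bar>" "\<bar>cIm z\<bar>"] by simp
  finally show ?thesis .
qed

instance complexification :: (banach_lattice) banach
proof
  fix X :: "nat \<Rightarrow> 'a complexification" assume X: "Cauchy X"
  have "Cauchy (\<lambda>n. cRe (X n))"
  proof (rule CauchyI)
    fix e :: real assume "0 < e"
    then obtain M where "\<forall>m\<ge>M. \<forall>n\<ge>M. norm (X m - X n) < e" using CauchyD[OF X] by blast
    then show "\<exists>M. \<forall>m\<ge>M. \<forall>n\<ge>M. norm (cRe (X m) - cRe (X n)) < e"
      by (metis cRe_simps(4) norm_cRe_le order_le_less_trans)
  qed
  moreover have "Cauchy (\<lambda>n. cIm (X n))"
  proof (rule CauchyI)
    fix e :: real assume "0 < e"
    then obtain M where "\<forall>m\<ge>M. \<forall>n\<ge>M. norm (X m - X n) < e" using CauchyD[OF X] by blast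
    then show "\<exists>M. \<forall>m\<ge>M. \<forall>n\<ge>M. norm (cIm (X m) - cIm (X n)) < e"
      by (metis cIm_simps(4) norm_cIm_le order_le_less_trans)
  qed
  ultimately obtain x y where xy: "(\<lambda>n. cRe (X n)) \<longlonglongrightarrow> x" "(\<lambda>n. cIm (X n)) \<longlonglongrightarrow> y"
    by (auto simp: Cauchy_convergent_iff convergent_def)
  have lim: "(\<lambda>n. norm (cRe (X n) - x) + norm (cIm (X n) - y)) \<longlonglongrightarrow> 0"
    using tendsto_add[OF tendsto_norm_zero[OF LIM_zero[OF xy(1)]]
        tendsto_norm_zero[OF LIM_zero[OF xy(2)]]] by simp
  have "norm (X n - Cplx x y) \<le> norm (cRe (X n) - x) + norm (cIm (X n) - y)" for n
    using norm_complexification_le[of "X n - Cplx x y"] by simp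
  then have "(\<lambda>n. X n - Cplx x y) \<longlonglongrightarrow> 0"
    by (intro Lim_null_comparison[OF always_eventually lim] allI)
  then show "convergent X" unfolding LIM_zero_iff by (rule convergentI)
qed

definition scaleC :: "complex \<Rightarrow> 'a :: banach_lattice complexification \<Rightarrow> 'a complexification"
  (infixr "*\<^sub>C" 75) where
  "c *\<^sub>C z = Cplx (Re c *\<^sub>R cRe z - Im c *\<^sub>R cIm z) (Re c *\<^sub>R cIm z + Im c *\<^sub>R cRe z)"

definition positive_cone :: "'a :: banach_lattice complexification set" where
  "positive_cone = {Cplx x 0 | x. 0 \<le> x}"


section \<open>Operators and semigroups\<close>

definition complex_linear ::
  "('a :: banach_lattice complexification \<Rightarrow> 'a complexification) \<Rightarrow> bool" where
  "complex_linear T \<longleftrightarrow>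
     (\<forall>z w. T (z + w) = T z + T w) \<and> (\<forall>c z. T (c *\<^sub>C z) = c *\<^sub>C T z)"

definition positive_operator ::
  "('a :: banach_lattice complexification \<Rightarrow> 'a complexification) \<Rightarrow> bool" where
  "positive_operator T \<longleftrightarrow> complex_linear T \<and> T ` positive_cone \<subseteq> positive_cone"

definition increasing_operators ::
  "(nat \<Rightarrow> 'a :: banach_lattice complexification \<Rightarrow> 'a complexification) \<Rightarrow> bool" where
  "increasing_operators P \<longleftrightarrow> (\<forall>n. positive_operator (\<lambda>z. P (Suc n) z - P n z))"

text \<open>
  A semigroup is a family indexed by all reals of which only the members with index \<open>t \<ge> 0\<close>
  are relevant. The generator is determined by the semigroup.
\<close>

definition C0_semigroup ::
  "(real \<Rightarrow> 'a :: banach_lattice complexification \<Rightarrow> 'a complexification) \<Rightarrow> bool" where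
  "C0_semigroup T \<longleftrightarrow>
     (\<forall>t\<ge>0. complex_linear (T t) \<and> bounded_linear (T t)) \<and>
     T 0 = id \<and>
     (\<forall>s\<ge>0. \<forall>t\<ge>0. T (s + t) = T s \<circ> T t) \<and>
     (\<forall>z. ((\<lambda>t. T t z) \<longlongrightarrow> z) (at_right 0))"

definition locally_eventually_positive ::
  "(real \<Rightarrow> 'a :: banach_lattice complexification \<Rightarrow> 'a complexification) \<Rightarrow>
   (nat \<Rightarrow> 'a complexification \<Rightarrow> 'a complexification) \<Rightarrow> bool" where
  "locally_eventually_positive T P \<longleftrightarrow>
     (\<forall>n. \<forall>f \<in> positive_cone - {0}. \<exists>\<tau>>0. \<forall>t\<ge>\<tau>. P n (T t f) \<in> positive_cone)"

end

(*
  Were the distance to the cone bounded below along some times tending to infinity, then by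
  compactness the orbit would have a cluster point y along these times. Each P n is continuous,
  since 0 <= P n f <= f for f in the cone, so the LEP property puts P n y into the closed cone
  for every n. As P n y converges to y, also y lies in the cone, a contradiction.
*)
theory Submission
  imports Defs
begin

lemma bounded_linear_cRe: "bounded_linear (cRe :: 'a :: banach_lattice complexification \<Rightarrow> 'a)"
  by (rule bounded_linear_intro[where K = 1]) (simp_all add: norm_cRe_le)

lemma bounded_linear_cIm: "bounded_linear (cIm :: 'a :: banach_lattice complexification \<Rightarrow> 'a)"
  by (rule bounded_linear_intro[where K = 1]) (simp_all add: norm_cIm_le)

lemma positive_cone_iff: "z \<in> positive_cone \<longleftrightarrow> 0 \<le> cRe z \<and> cIm z = 0"
  by (cases z) (auto simp: positive_cone_def)

text \<open>Both coordinate maps are continuous, and the cone of the real Banach lattice is closed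
  under limits.\<close>

lemma closed_positive_cone: "closed (positive_cone :: 'a :: banach_lattice complexification set)"
  unfolding closed_sequential_limits
proof (intro allI impI, elim conjE)
  fix Z :: "nat \<Rightarrow> 'a complexification" and z
  assume Z: "\<forall>n. Z n \<in> positive_cone" and lim: "Z \<longlonglongrightarrow> z"
  have "0 \<le> cRe z"
    using banach_lattice_LIMSEQ_nonneg[OF bounded_linear.tendsto[OF bounded_linear_cRe lim]] Z
    by (simp add: positive_cone_iff)
  moreover have "cIm z = 0"
    using bounded_linear.tendsto[OF bounded_linear_cIm lim] Z
    by (simp add: positive_cone_iff LIMSEQ_const_iff)
  ultimately show "z \<in> positive_cone" by (simp add: positive_cone_iff)
qed

lemma zero_in_positive_cone: "0 \<in> positive_cone"
  by (simp add: positive_cone_iff)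

lemma positive_cone_add: "z \<in> positive_cone \<Longrightarrow> w \<in> positive_cone \<Longrightarrow> z + w \<in> positive_cone"
  by (simp add: positive_cone_iff)

text \<open>On elements with vanishing imaginary part the norm is that of the real part, so
  monotonicity of the lattice norm carries over.\<close>

lemma norm_le_positive_cone:
  assumes "f \<in> positive_cone" "g - f \<in> positive_cone"
  shows "norm f \<le> norm g"
proof -
  have "norm f \<le> norm (cRe f)"
    using norm_complexification_le[of f] assms by (simp add: positive_cone_iff)
  also have "\<dots> \<le> norm (cRe g)"
    using assms by (intro banach_lattice_norm_mono) (simp_all add: positive_cone_iff)
  also have "\<dots> \<le> norm g" by (rule norm_cRe_le)
  finally show ?thesis .
qed

lemma complex_linear_diff:
  assumes "complex_linear L"
  shows "L (z - w) = L z - L w"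
  using assms unfolding complex_linear_def by (metis add_diff_cancel_right' diff_add_cancel)

lemma complex_linear_zero: "complex_linear L \<Longrightarrow> L 0 = 0"
  using complex_linear_diff[of L 0 0] by simp

text \<open>Bridges \<open>complex_linear\<close>, stated with complex scalars, and
  \<open>bounded_linear\<close>, which asks for real ones.\<close>

lemma complex_linear_scaleR:
  fixes L :: "'a :: banach_lattice complexification \<Rightarrow> 'a complexification"
  assumes "complex_linear L"
  shows "L (r *\<^sub>R z) = r *\<^sub>R L z"
proof -
  have "r *\<^sub>R w = complex_of_real r *\<^sub>C w" for w :: "'a complexification"
    by (simp add: complexification_eq_iff scaleC_def)
  then show ?thesis using assms unfolding complex_linear_def by simp
qed

text \<open>A crude bound, got by estimating the two coordinates separately; any constant would do
  for the boundedness proof below.\<close>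

lemma norm_ii_scaleC: "norm (\<i> *\<^sub>C z) \<le> 2 * norm z"
  using norm_complexification_le[of "\<i> *\<^sub>C z"] norm_cRe_le[of z] norm_cIm_le[of z]
  by (simp add: scaleC_def)

text \<open>Domination by the identity makes \<open>L\<close> contractive on the cone. Every element
  is a complex combination of four cone elements of controlled norm, so linearity spreads the bound
  to the whole space.\<close>

lemma bounded_linear_positive_operator_le_id:
  fixes L :: "'a :: banach_lattice complexification \<Rightarrow> 'a complexification"
  assumes L: "positive_operator L"
    and le_id: "\<And>f. f \<in> positive_cone \<Longrightarrow> f - L f \<in> positive_cone"
  shows "bounded_linear L"
proof -
  have lin: "complex_linear L" using L by (simp add: positive_operator_def)
  have cone: "norm (L f) \<le> norm f" if "f \<in> positive_cone" for f
    using L le_id that by (intro norm_le_positive_cone) (auto simp: positive_operator_def)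
  have real: "norm (L (Cplx u 0)) \<le> 3 * norm u" for u :: 'a
  proof -
    \<comment> \<open>The splitting \<open>u = \<bar>u\<bar> - (\<bar>u\<bar> - u)\<close> has both
      terms in the cone, with norms at most \<open>norm u\<close> and \<open>2 * norm u\<close>;
      hence the factor 3.\<close>
    define p n where "p = Cplx \<bar>u\<bar> 0" and "n = Cplx (\<bar>u\<bar> - u) 0"
    have "norm (L (Cplx u 0)) = norm (L p - L n)"
      unfolding complex_linear_diff[OF lin, symmetric]
      by (rule arg_cong[of _ _ "\<lambda>z. norm (L z)"]) (simp add: complexification_eq_iff p_def n_def)
    also have "\<dots> \<le> norm (L p) + norm (L n)" by (rule norm_triangle_ineq4)
    also have "\<dots> \<le> norm p + norm n"
      by (intro add_mono cone) (simp_all add: positive_cone_iff p_def n_def abs_ge_self)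
    also have "\<dots> \<le> norm \<bar>u\<bar> + norm (\<bar>u\<bar> - u)"
      using norm_complexification_le[of p] norm_complexification_le[of n] by (simp add: p_def n_def)
    also have "\<dots> \<le> 3 * norm u" using norm_triangle_ineq4[of "\<bar>u\<bar>" u] by simp
    finally show ?thesis .
  qed
  show ?thesis
  proof (rule bounded_linear_intro)
    fix z :: "'a complexification"
    have "z = Cplx (cRe z) 0 + \<i> *\<^sub>C Cplx (cIm z) 0"
      by (simp add: complexification_eq_iff scaleC_def)
    then have "L z = L (Cplx (cRe z) 0) + \<i> *\<^sub>C L (Cplx (cIm z) 0)"
      using lin unfolding complex_linear_def by metis
    then have "norm (L z) \<le> norm (L (Cplx (cRe z) 0)) + norm (\<i> *\<^sub>C L (Cplx (cIm z) 0))"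
      by (simp add: norm_triangle_ineq)
    \<comment> \<open>The constant is 3 for the real part plus 2 * 3 for the imaginary part, where
      the 2 pays for the multiplication by \<open>\<i>\<close>.\<close>
    then show "norm (L z) \<le> norm z * 9"
      using real[of "cRe z"] real[of "cIm z"] norm_ii_scaleC[of "L (Cplx (cIm z) 0)"]
        norm_cRe_le[of z] norm_cIm_le[of z] by linarith
  qed (use lin complex_linear_scaleR[OF lin] in \<open>auto simp: complex_linear_def\<close>)
qed

text \<open>The differences \<open>P (n + k) f - P n f\<close> telescope into sums of cone elements,
  and the cone is closed. With \<open>g = f\<close> this is the domination by the identity that
  makes each \<open>P n\<close> bounded.\<close>

lemma increasing_operators_le_limit:
  fixes P :: "nat \<Rightarrow> 'a :: banach_lattice complexification \<Rightarrow> 'a complexification"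
  assumes inc: "increasing_operators P" and lim: "(\<lambda>n. P n f) \<longlonglongrightarrow> g" and f: "f \<in> positive_cone"
  shows "g - P n f \<in> positive_cone"
proof -
  have "P (n + k) f - P n f \<in> positive_cone" for k
  proof (induction k)
    case (Suc k)
    have "P (Suc (n + k)) f - P (n + k) f \<in> positive_cone"
      using inc f by (auto simp: increasing_operators_def positive_operator_def)
    from positive_cone_add[OF this Suc.IH] show ?case by simp
  qed (simp add: zero_in_positive_cone)
  moreover have "(\<lambda>k. P (n + k) f - P n f) \<longlonglongrightarrow> g - P n f"
    using LIMSEQ_ignore_initial_segment[OF lim, of n]
    by (intro tendsto_diff tendsto_const) (simp add: add.commute)
  ultimately show ?thesis
    by (rule closed_sequentially[OF closed_positive_cone])
qed

theorem theorem3p4: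
  fixes P :: "nat \<Rightarrow> 'a :: banach_lattice complexification \<Rightarrow> 'a complexification"
    and T :: "real \<Rightarrow> 'a complexification \<Rightarrow> 'a complexification"
  assumes "\<And>n. positive_operator (P n)"
    and "increasing_operators P"
    and "\<And>z. (\<lambda>n. P n z) \<longlonglongrightarrow> z"
    and "C0_semigroup T"
    and "locally_eventually_positive T P"
    and "\<And>z. compact (closure {T t z | t. 0 \<le> t})"
    and "x \<in> positive_cone"
  shows "((\<lambda>t. infdist (T t x) positive_cone) \<longlongrightarrow> 0) at_top"
proof (rule ccontr)
  assume "\<not> ?thesis"
  then obtain e where e: "0 < e" "\<not> (\<forall>\<^sub>F t in at_top. infdist (T t x) positive_cone < e)"
    by (auto simp: tendsto_iff infdist_nonneg)
  then have "\<exists>t\<ge>real k. e \<le> infdist (T t x) positive_cone" for k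
    unfolding eventually_at_top_linorder by (meson not_le)
  then obtain t where t: "\<And>k. real k \<le> t k" "\<And>k. e \<le> infdist (T (t k) x) positive_cone"
    by metis
  have t0: "0 \<le> t k" for k
    using t(1)[of k] of_nat_0_le_iff order_trans by blast
  have "T (t k) x \<in> closure {T s x | s. 0 \<le> s}" for k
    by (rule subsetD[OF closure_subset]) (use t0 in blast)
  then obtain y r where r: "strict_mono r" and lim: "(\<lambda>k. T (t (r k)) x) \<longlonglongrightarrow> y"
    using seq_compactE[OF compact_imp_seq_compact[OF assms(6)], of "\<lambda>k. T (t k) x"]
    unfolding comp_def by blast
  \<comment> \<open>Passing to the subsequence keeps the times unbounded: k \<le> \<open>r k\<close>
    \<le> \<open>t (r k)\<close>.\<close>
  have t_lim: "filterlim (\<lambda>k. t (r k)) at_top sequentially"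
  proof (rule filterlim_at_top_mono[OF filterlim_real_sequentially always_eventually], rule allI)
    show "real k \<le> t (r k)" for k
      using t(1)[of "r k"] seq_suble[OF r, of k] by linarith
  qed
  have "P n y \<in> positive_cone" for n
  proof (rule Lim_in_closed_set[OF closed_positive_cone])
    have "bounded_linear (P n)"
      using assms(1) increasing_operators_le_limit[OF assms(2,3)]
      by (rule bounded_linear_positive_operator_le_id)
    then show "(\<lambda>k. P n (T (t (r k)) x)) \<longlonglongrightarrow> P n y"
      using lim by (rule bounded_linear.tendsto)
    show "\<forall>\<^sub>F k in sequentially. P n (T (t (r k)) x) \<in> positive_cone"
    \<comment> \<open>The LEP property speaks only of nonzero cone elements; the orbit of 0 stays at
      0 by linearity.\<close>
    proof (cases "x = 0")
      case True
      have "P n (T (t (r k)) x) = 0" for k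
        using assms(1,4) t0[of "r k"] True
        by (simp add: C0_semigroup_def positive_operator_def complex_linear_zero)
      then show ?thesis by (simp add: zero_in_positive_cone)
    next
      case False
      then obtain \<tau> where "\<forall>s\<ge>\<tau>. P n (T s x) \<in> positive_cone"
        using assms(5,7) unfolding locally_eventually_positive_def by blast
      then have "\<forall>\<^sub>F s in at_top. P n (T s x) \<in> positive_cone"
        unfolding eventually_at_top_linorder by blast
      then show ?thesis using t_lim by (rule eventually_compose_filterlim)
    qed
  qed simp
  then have "y \<in> positive_cone"
    using closed_sequentially[OF closed_positive_cone _ assms(3)] by simp
  \<comment> \<open>The distance to the cone is at most the distance to its member \<open>y\<close>,
    which falls below \<open>e\<close> although the times were chosen to keep it at least
    \<open>e\<close>.\<close>
  obtain k where "dist (T (t (r k)) x) y < e"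
    using metric_LIMSEQ_D[OF lim e(1)] by blast
  with infdist_le[OF \<open>y \<in> positive_cone\<close>, of "T (t (r k)) x"] t(2)[of "r k"]
  show False by linarith
qed

end
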